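(* Let $k\geqslant2$ be an integer not divisible by $4$, and let $H$ be a connected $k$-uniform hypergraph. Then the following are equivalent: (1) $k$ is even and $H$ is odd-bipartite; (2) $-\rho(\mathcal{A}_H)$ is an eigenvalue of $\mathcal{A}_H$.
   Context: A $k$-uniform hypergraph $H$ has a finite vertex set $V(H)=[n]$ and an edge set $E(H)$ of $k$-element subsets of $V(H)$; it is connected if any two vertices $u,v$ are joined by a sequence of edges $e_1,\ldots,e_m$ with $u\in e_1$, $v\in e_m$, $e_j\cap e_{j+1}\neq\emptyset$. $H$ is odd-bipartite if there is a proper subset $V_1\subsetneq V(H)$ such that every edge contains an odd number of vertices of $V_1$. The adjacency tensor $\mathcal{A}_H$ is the order $k$ dimension $n$ tensor with entries $\frac{1}{(k-1)!}$ at $(i_1,\ldots,i_k)$ if $\{i_1,\ldots,i_k\}\in E(H)$ and $0$ otherwise. For $x\in\mathbb{C}^n$, $(\mathcal{A}_Hx)_i=\sum_{i_2,\ldots,i_k}a_{ii_2\cdots i_k}x_{i_2}\cdots x_{i_k}$; $\lambda\in\mathbb{C}$ is an eigenvalue if $\mathcal{A}_Hx=\lambda x^{[k-1]}$ for some nonzero $x\in\mathbb{C}^n$, where $x^{[k-1]}=(x_1^{k-1},\ldots,x_n^{k-1})^\top$. $\rho(\mathcal{A}_H)$ is the maximum modulus of the eigenvalues of $\mathcal{A}_H$. *)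

theory Defs
  imports "HOL-Analysis.Analysis"
begin

text \<open>
  The vertex set \<open>[n]\<close> is the universe of a finite type \<open>'n\<close>, so that
  \<open>n = CARD('n)\<close> is an arbitrary positive integer; a hypergraph on it is given by its edge set.
\<close>

definition uniform_hypergraph :: "nat \<Rightarrow> 'n::finite set set \<Rightarrow> bool" where
  "uniform_hypergraph k E \<longleftrightarrow> (\<forall>e\<in>E. card e = k)"

text \<open>
  The vertices \<open>u\<close> and \<open>v\<close> may coincide and the edge sequence is nonempty, so a single vertex
  without edges is not connected. With at least two vertices, restricting to \<open>u \<noteq> v\<close>
  would define the same notion.
\<close>

definition connected_hypergraph :: "'n::finite set set \<Rightarrow> bool" where
  "connected_hypergraph E \<longleftrightarrow>
     (\<forall>u v. \<exists>es. es \<noteq> [] \<and> set es \<subseteq> E \<and> u \<in> hd es \<and> v \<in> last es \<and>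
        (\<forall>j. Suc j < length es \<longrightarrow> es ! j \<inter> es ! Suc j \<noteq> {}))"

definition odd_bipartite :: "'n::finite set set \<Rightarrow> bool" where
  "odd_bipartite E \<longleftrightarrow> (\<exists>V\<^sub>1. V\<^sub>1 \<subset> UNIV \<and> (\<forall>e\<in>E. odd (card (e \<inter> V\<^sub>1))))"

text \<open>
  A tensor of order \<open>k\<close> and dimension \<open>n\<close> is represented by its entries, indexed by the lists
  \<open>[i\<^sub>1, \<dots>, i\<^sub>k]\<close>; only its values on lists of length \<open>k\<close> are relevant.
\<close>

type_synonym 'n tensor = "'n list \<Rightarrow> complex"

definition tensor_vec :: "nat \<Rightarrow> 'n::finite tensor \<Rightarrow> complex ^ 'n \<Rightarrow> complex ^ 'n" where
  "tensor_vec k A x =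
     (\<chi> i. \<Sum>js | length js = k - 1. A (i # js) * (\<Prod>j\<leftarrow>js. x $ j))"

definition tensor_eigenvalue :: "nat \<Rightarrow> 'n::finite tensor \<Rightarrow> complex \<Rightarrow> bool" where
  "tensor_eigenvalue k A \<mu> \<longleftrightarrow>
     (\<exists>x. x \<noteq> 0 \<and> tensor_vec k A x = (\<chi> i. \<mu> * (x $ i) ^ (k - 1)))"

definition tensor_spectral_radius :: "nat \<Rightarrow> 'n::finite tensor \<Rightarrow> real" where
  "tensor_spectral_radius k A = (GREATEST r. \<exists>\<mu>. tensor_eigenvalue k A \<mu> \<and> r = cmod \<mu>)"

definition adjacency_tensor :: "nat \<Rightarrow> 'n::finite set set \<Rightarrow> 'n tensor" where
  "adjacency_tensor k E idx =
     (if length idx = k \<and> set idx \<in> E then 1 / fact (k - 1) else 0)"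

end

theory Submission
  imports Defs "HOL-Combinatorics.Multiset_Permutations"
begin

text \<open>
  Maximising \<open>\<Sum>\<^sub>e \<Prod>\<^sub>j\<^sub>\<in>\<^sub>e x\<^sub>j\<close> over the nonnegative unit sphere of the \<open>k\<close>-norm yields a positive
  eigenvector \<open>x\<close>, and comparing \<open>\<bar>z\<bar>\<close> with the least multiple of \<open>x\<close> above it shows that the
  eigenvalue of \<open>x\<close> is the spectral radius \<open>\<rho>\<close> and that \<open>\<bar>z\<bar>\<close> is a multiple of \<open>x\<close> whenever \<open>z\<close> is an
  eigenvector for an eigenvalue of modulus \<open>\<rho>\<close>. For the eigenvalue \<open>-\<rho>\<close>, equality in the triangle
  inequality forces the phases \<open>\<theta>\<^sub>j\<close> of \<open>z\<close> to satisfy \<open>\<Prod>\<^sub>j\<^sub>\<in>\<^sub>e \<theta>\<^sub>j = -\<theta>\<^sub>i\<^sup>k\<close> for \<open>i \<in> e\<close>. Hence \<open>\<theta>\<^sub>i\<^sup>k = c\<close>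
  is constant by connectedness, and raising the product over an edge to the \<open>k\<close>-th power gives
  \<open>(-c)\<^sup>k = c\<^sup>k\<close>, so \<open>k\<close> is even. With \<open>m = k/2\<close> odd, the signs \<open>(\<theta>\<^sub>j/\<theta>\<^sub>a)\<^sup>m\<close> multiply
  to \<open>(-1)\<^sup>m = -1\<close> over each edge, and the vertices of sign \<open>-1\<close> form the odd bipartition. Conversely,
  flipping the signs of \<open>x\<close> on one part of an odd bipartition turns \<open>\<rho>\<close> into \<open>-\<rho>\<close>.
\<close>

section \<open>The adjacency tensor as a sum over edges\<close>

definition link_sum :: "'n::finite set set \<Rightarrow> ('n \<Rightarrow> 'a::comm_semiring_1) \<Rightarrow> 'n \<Rightarrow> 'a" where
  "link_sum E x i = (\<Sum>e | e \<in> E \<and> i \<in> e. \<Prod>j\<in>e - {i}. x j)"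

text \<open>For a \<open>k\<close>-uniform \<open>E\<close>, this is the homogeneous form of the
  adjacency tensor divided by \<open>k\<close>; its partial derivative at \<open>i\<close> is
  \<open>link_sum E x i\<close>.\<close>

definition edge_sum :: "'n::finite set set \<Rightarrow> ('n \<Rightarrow> 'a::comm_semiring_1) \<Rightarrow> 'a" where
  "edge_sum E x = (\<Sum>e\<in>E. \<Prod>j\<in>e. x j)"

text \<open>An edge \<open>e\<close> through \<open>i\<close> arises from exactly the
  \<open>fact (k - 1)\<close> orderings of \<open>e - {i}\<close>, which cancel the normalising
  factor of the tensor.\<close>

lemma tensor_vec_adjacency:
  fixes E :: "'n::finite set set"
  assumes "k > 0" and "uniform_hypergraph k E"
  shows "tensor_vec k (adjacency_tensor k E) x $ i = link_sum E (($) x) i"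
proof -
  let ?F = "{e \<in> E. i \<in> e}"
  have fin: "finite {js :: 'n list. length js = k - 1}"
    using finite_lists_length_eq[of "UNIV :: 'n set" "k - 1"] by simp
  have perms: "{js. length js = k - 1 \<and> insert i (set js) = e} = permutations_of_set (e - {i})"
    if "e \<in> ?F" for e
  proof -
    have c: "card e = k" "i \<in> e" using that assms by (auto simp: uniform_hypergraph_def)
    hence c1: "card (e - {i}) = k - 1" by simp
    show ?thesis
    proof (intro set_eqI iffI)
      fix js assume "js \<in> {js. length js = k - 1 \<and> insert i (set js) = e}"
      hence l: "length js = k - 1" and s: "insert i (set js) = e" by auto
      \<comment> \<open>Counting excludes repetitions: \<open>k - 1\<close> entries have to cover
        the \<open>k - 1\<close> vertices of \<open>e - {i}\<close>, so \<open>js\<close> also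
        avoids \<open>i\<close>.\<close>
      have "e - {i} \<subseteq> set js" using s by auto
      moreover have "card (set js) \<le> k - 1" using l card_length[of js] by simp
      ultimately have eq: "e - {i} = set js" using c1 by (intro card_seteq) auto
      hence "distinct js" using c1 l by (intro card_distinct) auto
      thus "js \<in> permutations_of_set (e - {i})" using eq by (auto simp: permutations_of_set_def)
    next
      fix js assume js: "js \<in> permutations_of_set (e - {i})"
      hence "length js = k - 1"
        using c1 distinct_card[of js] by (simp add: permutations_of_set_def)
      thus "js \<in> {js. length js = k - 1 \<and> insert i (set js) = e}"
        using js c by (auto simp: permutations_of_set_def)
    qed
  qed
  have "tensor_vec k (adjacency_tensor k E) x $ i =
      (\<Sum>js | length js = k - 1 \<and> insert i (set js) \<in> E. (\<Prod>j\<leftarrow>js. x $ j) / fact (k - 1))"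
    unfolding tensor_vec_def adjacency_tensor_def vec_lambda_beta
    using assms(1) by (intro sum.mono_neutral_cong_right fin) auto
  also have "\<dots> = (\<Sum>e\<in>?F. \<Sum>js | js \<in> {js. length js = k - 1 \<and> insert i (set js) \<in> E} \<and>
      insert i (set js) = e. (\<Prod>j\<leftarrow>js. x $ j) / fact (k - 1))"
    by (rule sum.group[symmetric]) (auto intro: finite_subset[OF _ fin])
  also have "\<dots> = (\<Sum>e\<in>?F. \<Sum>js\<in>permutations_of_set (e - {i}). (\<Prod>j\<leftarrow>js. x $ j) / fact (k - 1))"
  proof (rule sum.cong[OF refl])
    fix e assume e: "e \<in> ?F"
    have "{js. js \<in> {js. length js = k - 1 \<and> insert i (set js) \<in> E} \<and> insert i (set js) = e} =
        {js. length js = k - 1 \<and> insert i (set js) = e}"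
      using e by blast
    thus "(\<Sum>js | js \<in> {js. length js = k - 1 \<and> insert i (set js) \<in> E} \<and> insert i (set js) = e.
        (\<Prod>j\<leftarrow>js. x $ j) / fact (k - 1)) =
      (\<Sum>js\<in>permutations_of_set (e - {i}). (\<Prod>j\<leftarrow>js. x $ j) / fact (k - 1))"
      by (simp only: perms[OF e])
  qed
  also have "\<dots> = (\<Sum>e\<in>?F. \<Sum>js\<in>permutations_of_set (e - {i}). (\<Prod>j\<in>e - {i}. x $ j) / fact (k - 1))"
  proof (rule sum.cong[OF refl], rule sum.cong[OF refl])
    fix e js assume "js \<in> permutations_of_set (e - {i})"
    hence "set js = e - {i}" "distinct js" by (auto simp: permutations_of_set_def)
    thus "(\<Prod>j\<leftarrow>js. x $ j) / fact (k - 1) = (\<Prod>j\<in>e - {i}. x $ j) / fact (k - 1)"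
      using prod.distinct_set_conv_list[of js "($) x"] by simp
  qed
  also have "\<dots> = (\<Sum>e\<in>?F. \<Prod>j\<in>e - {i}. x $ j)"
    using assms(2) by (intro sum.cong refl) (auto simp: uniform_hypergraph_def)
  finally show ?thesis by (simp add: link_sum_def)
qed

lemma tensor_eigenvalue_adjacency_iff:
  assumes "k > 0" and "uniform_hypergraph k E"
  shows "tensor_eigenvalue k (adjacency_tensor k E) \<mu> \<longleftrightarrow>
    (\<exists>x. (\<exists>i. x i \<noteq> 0) \<and> (\<forall>i. link_sum E x i = \<mu> * x i ^ (k - 1)))"
proof
  assume "tensor_eigenvalue k (adjacency_tensor k E) \<mu>"
  then obtain x where "x \<noteq> 0" "tensor_vec k (adjacency_tensor k E) x = (\<chi> i. \<mu> * (x $ i) ^ (k - 1))"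
    by (auto simp: tensor_eigenvalue_def)
  thus "\<exists>x. (\<exists>i. x i \<noteq> 0) \<and> (\<forall>i. link_sum E x i = \<mu> * x i ^ (k - 1))"
    by (intro exI[of _ "($) x"]) (auto simp: vec_eq_iff tensor_vec_adjacency[OF assms])
next
  assume "\<exists>x. (\<exists>i. x i \<noteq> 0) \<and> (\<forall>i. link_sum E x i = \<mu> * x i ^ (k - 1))"
  then obtain x where x: "\<exists>i. x i \<noteq> 0" "\<And>i. link_sum E x i = \<mu> * x i ^ (k - 1)" by auto
  have [simp]: "($) (vec_lambda x) = x" by auto
  show "tensor_eigenvalue k (adjacency_tensor k E) \<mu>"
    unfolding tensor_eigenvalue_def using x
    by (intro exI[of _ "vec_lambda x"]) (auto simp: vec_eq_iff tensor_vec_adjacency[OF assms])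
qed

text \<open>Consecutive edges of a joining sequence share a vertex, which hands \<open>P\<close> on
  from one edge to the next.\<close>

lemma connected_hypergraph_induct:
  assumes "connected_hypergraph E" and "P u"
    and step: "\<And>e i j. e \<in> E \<Longrightarrow> i \<in> e \<Longrightarrow> j \<in> e \<Longrightarrow> P i \<Longrightarrow> P j"
  shows "P v"
proof -
  have chain: "P b" if "es \<noteq> []" "set es \<subseteq> E" "a \<in> hd es" "b \<in> last es"
      "\<forall>j. Suc j < length es \<longrightarrow> es ! j \<inter> es ! Suc j \<noteq> {}" "P a" for es a b
    using that
  proof (induction es arbitrary: a)
    case (Cons e es)
    show ?case
    proof (cases "es = []")
      case True
      thus ?thesis using Cons.prems step[of e a b] by auto
    next
      case False
      hence "e \<inter> hd es \<noteq> {}" using Cons.prems(5)[rule_format, of 0] by (simp add: hd_conv_nth)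
      then obtain c where c: "c \<in> e" "c \<in> hd es" by auto
      have "P c" using Cons.prems step[of e a c] c by auto
      moreover have "\<forall>j. Suc j < length es \<longrightarrow> es ! j \<inter> es ! Suc j \<noteq> {}"
        using Cons.prems(5) by (metis Suc_less_eq length_Cons nth_Cons_Suc)
      ultimately show ?thesis using Cons.IH[of c] Cons.prems False c by auto
    qed
  qed simp
  obtain es where "es \<noteq> []" "set es \<subseteq> E" "u \<in> hd es" "v \<in> last es"
      "\<forall>j. Suc j < length es \<longrightarrow> es ! j \<inter> es ! Suc j \<noteq> {}"
    using assms(1) unfolding connected_hypergraph_def by meson
  thus ?thesis using chain assms(2) by blast
qed

text \<open>Joining sequences are nonempty, so the first edge of one starting at \<open>i\<close>
  serves.\<close>

lemma connected_hypergraph_covers: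
  assumes "connected_hypergraph E"
  obtains e where "e \<in> E" "i \<in> e"
  using assms unfolding connected_hypergraph_def by (metis hd_in_set subsetD)

section \<open>Existence of a positive eigenvector\<close>

lemma edge_sum_fun_upd:
  fixes x :: "'n::finite \<Rightarrow> 'a::comm_ring_1"
  shows "edge_sum E (x(i := t)) = (\<Sum>e | e \<in> E \<and> i \<notin> e. \<Prod>j\<in>e. x j) + t * link_sum E x i"
proof -
  have "edge_sum E (x(i := t)) = (\<Sum>e\<in>{e \<in> E. i \<notin> e} \<union> {e \<in> E. i \<in> e}. \<Prod>j\<in>e. (x(i := t)) j)"
    unfolding edge_sum_def by (rule arg_cong[where f = "sum _"]) auto
  also have "\<dots> = (\<Sum>e | e \<in> E \<and> i \<notin> e. \<Prod>j\<in>e. (x(i := t)) j)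
      + (\<Sum>e | e \<in> E \<and> i \<in> e. \<Prod>j\<in>e. (x(i := t)) j)"
    by (rule sum.union_disjoint) auto
  also have "(\<Sum>e | e \<in> E \<and> i \<notin> e. \<Prod>j\<in>e. (x(i := t)) j) = (\<Sum>e | e \<in> E \<and> i \<notin> e. \<Prod>j\<in>e. x j)"
    by (intro sum.cong prod.cong) auto
  also have "(\<Sum>e | e \<in> E \<and> i \<in> e. \<Prod>j\<in>e. (x(i := t)) j) = t * link_sum E x i"
    unfolding link_sum_def sum_distrib_left
  proof (intro sum.cong refl)
    fix e assume "e \<in> {e \<in> E. i \<in> e}"
    hence "(\<Prod>j\<in>e. (x(i := t)) j) = t * (\<Prod>j\<in>e - {i}. (x(i := t)) j)"
      by (subst prod.remove[of e i]) auto
    also have "(\<Prod>j\<in>e - {i}. (x(i := t)) j) = (\<Prod>j\<in>e - {i}. x j)" by (intro prod.cong) auto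
    finally show "(\<Prod>j\<in>e. (x(i := t)) j) = t * (\<Prod>j\<in>e - {i}. x j)" .
  qed
  finally show ?thesis .
qed

lemma edge_sum_scale:
  assumes "uniform_hypergraph k E"
  shows "edge_sum E (\<lambda>j. c * x j) = c ^ k * edge_sum E x"
  using assms unfolding edge_sum_def sum_distrib_left
  by (intro sum.cong refl) (auto simp: prod.distrib uniform_hypergraph_def)

text \<open>Compactness gives a maximiser on the unit sphere \<open>S\<close>. Both sides of the
  bound are homogeneous of degree \<open>k\<close>, so it extends to all nonnegative vectors and can
  be tested on perturbations that leave \<open>S\<close>.\<close>

lemma edge_sum_maximiser_exists:
  fixes E :: "'n::finite set set"
  assumes "k > 0" and unif: "uniform_hypergraph k E"
  obtains x :: "'n \<Rightarrow> real" and M where "\<And>i. x i \<ge> 0" "\<exists>i. x i > 0"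
    "edge_sum E x = M * (\<Sum>i\<in>UNIV. x i ^ k)"
    "\<And>y. (\<And>i. y i \<ge> 0) \<Longrightarrow> edge_sum E y \<le> M * (\<Sum>i\<in>UNIV. y i ^ k)"
proof -
  define S where "S = {x :: real ^ 'n. (\<forall>i. 0 \<le> x $ i) \<and> (\<Sum>i\<in>UNIV. (x $ i) ^ k) = 1}"
  have le1: "x $ i \<le> 1" if "x \<in> S" for x i
  proof (rule ccontr)
    assume "\<not> x $ i \<le> 1"
    hence "1 < (x $ i) ^ k" using assms(1) by (intro one_less_power) auto
    also have "\<dots> \<le> (\<Sum>i\<in>UNIV. (x $ i) ^ k)"
      using that by (intro member_le_sum) (auto simp: S_def)
    finally show False using that by (simp add: S_def)
  qed
  have "bounded S"
  proof (rule boundedI)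
    fix x assume x: "x \<in> S"
    have "norm x \<le> (\<Sum>i\<in>UNIV. \<bar>x $ i\<bar>)" by (rule norm_le_l1_cart)
    also have "\<dots> \<le> (\<Sum>i\<in>(UNIV :: 'n set). 1)"
      using x le1[OF x] by (intro sum_mono) (auto simp: S_def)
    finally show "norm x \<le> real CARD('n)" by simp
  qed
  moreover have "closed S"
    unfolding S_def by (intro closed_Collect_conj closed_Collect_all closed_Collect_le
        closed_Collect_eq continuous_intros)
  ultimately have "compact S" by (simp add: compact_eq_bounded_closed)
  moreover have "S \<noteq> {}"
  proof -
    obtain a :: 'n where True by simp
    have "(\<Sum>i\<in>UNIV. (axis a 1 $ i :: real) ^ k) = (\<Sum>i\<in>UNIV. if i = a then 1 else 0)"
      using assms(1) by (intro sum.cong) (auto simp: axis_def zero_power)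
    hence "axis a 1 \<in> S" by (auto simp: S_def axis_def)
    thus ?thesis by blast
  qed
  moreover have "continuous_on S (\<lambda>x. edge_sum E (($) x))"
    unfolding edge_sum_def by (intro continuous_intros)
  ultimately have "\<exists>x\<in>S. \<forall>y\<in>S. edge_sum E (($) y) \<le> edge_sum E (($) x)"
    by (rule continuous_attains_sup)
  then obtain x where x: "x \<in> S" and max: "\<And>y. y \<in> S \<Longrightarrow> edge_sum E (($) y) \<le> edge_sum E (($) x)"
    by blast
  define M where "M = edge_sum E (($) x)"
  have bound: "edge_sum E y \<le> M * (\<Sum>i\<in>UNIV. y i ^ k)" if nonneg: "\<And>i. y i \<ge> 0" for y
  proof (cases "\<forall>i. y i = 0")
    case True
    hence y: "y = (\<lambda>_. 0)" by auto
    show ?thesis using edge_sum_scale[OF unif, of 0 "\<lambda>_. 0 :: real"] assms(1)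
      by (simp add: y zero_power)
  next
    case False
    then obtain a where a: "y a > 0" using nonneg by (metis less_eq_real_def)
    define R where "R = (\<Sum>i\<in>UNIV. y i ^ k)"
    define c where "c = root k R"
    have "0 < y a ^ k" using a by simp
    also have "\<dots> \<le> R" unfolding R_def by (rule member_le_sum) (auto simp: nonneg)
    finally have R: "R > 0" .
    hence c: "c > 0" "c ^ k = R" using assms(1) by (auto simp: c_def)
    \<comment> \<open>Dividing by the \<open>k\<close>-norm \<open>c\<close> of \<open>y\<close>
      moves it onto \<open>S\<close>.\<close>
    define z :: "real ^ 'n" where "z = (\<chi> i. inverse c * y i)"
    have z: "($) z = (\<lambda>i. inverse c * y i)" by (auto simp: z_def)
    have "(\<Sum>i\<in>UNIV. (z $ i) ^ k) = 1"
      using c R by (simp add: z_def power_mult_distrib sum_distrib_left[symmetric] R_def[symmetric] power_inverse)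
    hence "z \<in> S" using c nonneg by (auto simp: S_def z_def)
    hence "inverse R * edge_sum E y \<le> M"
      using max[of z] c by (simp add: M_def z edge_sum_scale[OF unif] power_inverse)
    thus ?thesis using R by (simp add: R_def[symmetric] field_simps)
  qed
  have "\<exists>i. x $ i > 0"
  proof (rule ccontr)
    assume "\<not> ?thesis"
    hence "x $ i = 0" for i using x by (auto simp: S_def not_less intro: antisym)
    thus False using x assms(1) by (auto simp: S_def zero_power)
  qed
  with x bound show ?thesis by (intro that[of "($) x" M]) (auto simp: S_def M_def)
qed

text \<open>The maximiser has full support: if it vanished on \<open>Z \<noteq> {}\<close>, some edge would meet both \<open>Z\<close> and
  its complement, and raising the values on \<open>Z\<close> to \<open>\<epsilon>\<close> would gain a multiple of \<open>\<epsilon>\<^sup>z\<close> with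
  \<open>z < k\<close> at the cost of a multiple of \<open>\<epsilon>\<^sup>k\<close>.\<close>

lemma edge_sum_maximiser_pos:
  fixes x :: "'n::finite \<Rightarrow> real"
  assumes unif: "uniform_hypergraph k E" and conn: "connected_hypergraph E"
    and nonneg: "\<And>i. x i \<ge> 0" and nz: "\<exists>i. x i > 0"
    and eq: "edge_sum E x = M * (\<Sum>i\<in>UNIV. x i ^ k)"
    and max: "\<And>y. (\<And>i. y i \<ge> 0) \<Longrightarrow> edge_sum E y \<le> M * (\<Sum>i\<in>UNIV. y i ^ k)"
  shows "x i > 0"
proof (rule ccontr)
  assume "\<not> x i > 0"
  obtain a where a: "x a > 0" using nz by blast
  \<comment> \<open>Otherwise positivity would spread along edges from \<open>a\<close> to
    \<open>i\<close>.\<close>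
  have "\<exists>e p q. e \<in> E \<and> p \<in> e \<and> q \<in> e \<and> x p > 0 \<and> \<not> x q > 0"
    using connected_hypergraph_induct[OF conn, of "\<lambda>i. x i > 0" a i] a \<open>\<not> x i > 0\<close> by blast
  then obtain e p q where e: "e \<in> E" "p \<in> e" "q \<in> e" "x p > 0" "\<not> x q > 0" by blast
  hence q: "x q = 0" using nonneg[of q] by simp
  define Z where "Z = {i. x i = 0}"
  define z where "z = card (e \<inter> Z)"
  define c where "c = (\<Prod>j\<in>e - Z. x j)"
  have card_e: "card e = k" using unif e by (auto simp: uniform_hypergraph_def)
  have "p \<notin> Z" using e by (simp add: Z_def)
  hence "e \<inter> Z \<subset> e" using e by blast
  hence "z < card e" unfolding z_def by (intro psubset_card_mono) auto
  hence z: "z < k" using card_e by simp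
  have k0: "k > 0" using z by simp
  have c: "c > 0" unfolding c_def using nonneg by (intro prod_pos) (auto simp: Z_def less_le)
  have key: "c \<le> M * card Z * \<epsilon>" if \<epsilon>: "0 < \<epsilon>" "\<epsilon> \<le> 1" for \<epsilon>
  proof -
    define y where "y = (\<lambda>i. if i \<in> Z then \<epsilon> else x i)"
    have y0: "y i \<ge> 0" for i using \<epsilon> nonneg by (auto simp: y_def)
    have xy: "x i \<le> y i" for i using \<epsilon> by (auto simp: y_def Z_def)
    have "(\<Prod>j\<in>e. y j) = (\<Prod>j\<in>e \<inter> Z. y j) * (\<Prod>j\<in>e - Z. y j)"
      by (subst prod.union_disjoint[symmetric]) (auto intro!: prod.cong)
    also have "(\<Prod>j\<in>e \<inter> Z. y j) = \<epsilon> ^ z" by (simp add: y_def z_def)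
    also have "(\<Prod>j\<in>e - Z. y j) = c" unfolding c_def by (intro prod.cong) (auto simp: y_def)
    finally have pe: "(\<Prod>j\<in>e. y j) = \<epsilon> ^ z * c" .
    have px: "(\<Prod>j\<in>e. x j) = 0" using e q by (auto intro!: prod_zero)
    \<comment> \<open>The product over \<open>e\<close> rises from 0 to
      \<open>\<epsilon> ^ z * c\<close>, and no other edge product decreases.\<close>
    have "edge_sum E x + \<epsilon> ^ z * c = (\<Sum>e\<in>E - {e}. \<Prod>j\<in>e. x j) + \<epsilon> ^ z * c"
      unfolding edge_sum_def using e px by (subst sum.remove[of E e]) auto
    also have "\<dots> \<le> (\<Sum>e\<in>E - {e}. \<Prod>j\<in>e. y j) + (\<Prod>j\<in>e. y j)"
      unfolding pe using nonneg xy by (intro add_right_mono sum_mono prod_mono) auto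
    also have "\<dots> = edge_sum E y" unfolding edge_sum_def using e by (subst sum.remove[of E e]) auto
    also have "\<dots> \<le> M * (\<Sum>i\<in>UNIV. y i ^ k)" by (rule max) (rule y0)
    also have "(\<Sum>i\<in>UNIV. y i ^ k) = (\<Sum>i\<in>UNIV. x i ^ k + (if i \<in> Z then \<epsilon> ^ k else 0))"
      using k0 by (intro sum.cong) (auto simp: y_def Z_def zero_power)
    also have "\<dots> = (\<Sum>i\<in>UNIV. x i ^ k) + card Z * \<epsilon> ^ k" by (simp add: sum.distrib sum.If_cases)
    finally have "\<epsilon> ^ z * c \<le> M * card Z * \<epsilon> ^ k" using eq by (simp add: algebra_simps)
    also have "\<epsilon> ^ k = \<epsilon> ^ z * \<epsilon> ^ (k - z)" using z by (simp add: power_add[symmetric])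
    finally have cl: "c \<le> M * card Z * \<epsilon> ^ (k - z)" using \<epsilon> by (simp add: mult_ac)
    \<comment> \<open>This sign allows \<open>\<epsilon> ^ (k - z)\<close> to be replaced by the
      larger \<open>\<epsilon>\<close>, as \<open>k - z\<close> is at least 1 and
      \<open>\<epsilon> \<le> 1\<close>.\<close>
    have "0 < M * card Z"
    proof (rule ccontr)
      assume "\<not> 0 < M * card Z"
      hence "M * card Z * \<epsilon> ^ (k - z) \<le> 0" using \<epsilon> by (simp only: not_less mult_nonpos_nonneg zero_le_power less_imp_le)
      thus False using cl c by simp
    qed
    moreover have "\<epsilon> ^ (k - z) \<le> \<epsilon> ^ 1" using \<epsilon> z by (intro power_decreasing) auto
    ultimately have "M * card Z * \<epsilon> ^ (k - z) \<le> M * card Z * \<epsilon>" by (intro mult_left_mono) auto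
    with cl show ?thesis by simp
  qed
  have pos: "M * card Z > 0" using key[of 1] c by simp
  \<comment> \<open>Chosen so that \<open>key\<close> bounds \<open>c\<close> by
    \<open>c / 2\<close>.\<close>
  define \<epsilon> where "\<epsilon> = min 1 (c / (2 * (M * card Z)))"
  have "c \<le> M * card Z * \<epsilon>" by (rule key) (use pos c in \<open>auto simp: \<epsilon>_def\<close>)
  also have "\<dots> \<le> M * card Z * (c / (2 * (M * card Z)))"
    using pos by (intro mult_left_mono) (auto simp: \<epsilon>_def)
  also have "\<dots> = c / 2" using pos by (auto simp: field_simps)
  finally show False using c by simp
qed

text \<open>The eigenvector equation is the first-order condition at the positive maximiser, taken
  one coordinate at a time; the eigenvalue is \<open>M * k\<close>.\<close>

lemma perron_vector_exists:
  fixes E :: "'n::finite set set"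
  assumes "k > 0" and unif: "uniform_hypergraph k E" and conn: "connected_hypergraph E"
  obtains x :: "'n \<Rightarrow> real" and \<rho> where "\<rho> \<ge> 0" "\<And>i. x i > 0" "\<And>i. link_sum E x i = \<rho> * x i ^ (k - 1)"
proof -
  obtain x :: "'n \<Rightarrow> real" and M where x: "\<And>i. x i \<ge> 0" "\<exists>i. x i > 0"
    "edge_sum E x = M * (\<Sum>i\<in>UNIV. x i ^ k)"
    and max: "\<And>y. (\<And>i. y i \<ge> 0) \<Longrightarrow> edge_sum E y \<le> M * (\<Sum>i\<in>UNIV. y i ^ k)"
    using edge_sum_maximiser_exists[OF assms(1,2)] by metis
  have pos: "x i > 0" for i using edge_sum_maximiser_pos[OF unif conn x max] .
  have crit: "link_sum E x i = M * k * x i ^ (k - 1)" for i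
  proof -
    define R where "R = (\<Sum>j\<in>UNIV - {i}. x j ^ k)"
    define a where "a = (\<Sum>e | e \<in> E \<and> i \<notin> e. \<Prod>j\<in>e. x j)"
    \<comment> \<open>The gap in the maximality bound when coordinate \<open>i\<close> is set to
      \<open>t\<close>; the edge sum is affine in \<open>t\<close> with slope
      \<open>link_sum E x i\<close>.\<close>
    define \<phi> where "\<phi> = (\<lambda>t. M * (t ^ k + R) - (a + t * link_sum E x i))"
    have upd: "(\<Sum>j\<in>UNIV. (x(i := t)) j ^ k) = t ^ k + R" for t
      unfolding R_def by (subst sum.remove[of UNIV i]) auto
    have \<phi>: "\<phi> t = M * (\<Sum>j\<in>UNIV. (x(i := t)) j ^ k) - edge_sum E (x(i := t))" for t
      unfolding upd edge_sum_fun_upd \<phi>_def a_def ..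
    have "\<phi> (x i) = 0" unfolding \<phi> using x by simp
    moreover have "\<phi> t \<ge> 0" if "t \<ge> 0" for t
      unfolding \<phi> using max[of "x(i := t)"] that x by simp
    moreover have "DERIV \<phi> (x i) :> M * (k * x i ^ (k - 1)) - link_sum E x i"
      unfolding \<phi>_def by (auto intro!: derivative_eq_intros)
    ultimately have "M * (k * x i ^ (k - 1)) - link_sum E x i = 0"
      \<comment> \<open>Since \<open>x i > 0\<close>, the whole neighbourhood of radius
        \<open>x i\<close> consists of positive \<open>t\<close>, so the minimum is
        interior.\<close>
      using pos[of i] by (intro DERIV_local_min[of \<phi> _ "x i" "x i"]) (auto simp: abs_if split: if_splits)
    thus ?thesis by simp
  qed
  have "M * k \<ge> 0"
  proof -
    fix i
    have "link_sum E x i \<ge> 0" unfolding link_sum_def using x by (intro sum_nonneg prod_nonneg) auto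
    thus ?thesis using crit[of i] zero_less_power[OF pos[of i], of "k - 1"]
      by (metis mult_neg_pos not_less)
  qed
  thus ?thesis using that pos crit by blast
qed

section \<open>Comparison with the positive eigenvector\<close>

lemma link_sum_scale:
  assumes "uniform_hypergraph k E"
  shows "link_sum E (\<lambda>j. c * x j) i = c ^ (k - 1) * link_sum E x i"
  using assms unfolding link_sum_def sum_distrib_left
  by (intro sum.cong refl) (auto simp: prod.distrib uniform_hypergraph_def)

lemma link_sum_mono:
  fixes x y :: "'n::finite \<Rightarrow> real"
  assumes "\<And>j. 0 \<le> x j" "\<And>j. x j \<le> y j"
  shows "link_sum E x i \<le> link_sum E y i"
  unfolding link_sum_def using assms by (intro sum_mono prod_mono) auto

lemma norm_link_sum_le:
  fixes z :: "'n::finite \<Rightarrow> complex"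
  shows "cmod (link_sum E z i) \<le> link_sum E (\<lambda>j. cmod (z j)) i"
  unfolding link_sum_def by (rule order.trans[OF norm_sum]) (simp add: prod_norm)

text \<open>One strict inequality would survive multiplication by the other factors, because the
  \<open>g j\<close> are positive.\<close>

lemma prod_eq_imp_eq:
  fixes f g :: "'a \<Rightarrow> real"
  assumes "finite A" "\<And>j. j \<in> A \<Longrightarrow> 0 \<le> f j" "\<And>j. j \<in> A \<Longrightarrow> f j \<le> g j" "\<And>j. j \<in> A \<Longrightarrow> 0 < g j"
    and eq: "(\<Prod>j\<in>A. f j) = (\<Prod>j\<in>A. g j)" and "j \<in> A"
  shows "f j = g j"
proof (rule ccontr)
  assume "f j \<noteq> g j"
  hence lt: "f j < g j" using assms by (simp add: less_le)
  have "(\<Prod>j\<in>A. f j) = f j * (\<Prod>j\<in>A - {j}. f j)" using assms by (simp add: prod.remove)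
  also have "\<dots> \<le> f j * (\<Prod>j\<in>A - {j}. g j)" using assms by (intro mult_left_mono prod_mono) auto
  also have "\<dots> < g j * (\<Prod>j\<in>A - {j}. g j)" using assms lt by (intro mult_strict_right_mono prod_pos) auto
  also have "\<dots> = (\<Prod>j\<in>A. g j)" using assms by (simp add: prod.remove)
  finally show False using eq by simp
qed

text \<open>A fixed positive eigenvector. That its eigenvalue \<open>\<rho>\<close> is the spectral
  radius is derived in \<open>spectral_radius\<close>.\<close>

locale perron_vector =
  fixes k :: nat and E :: "'n::finite set set" and x :: "'n \<Rightarrow> real" and \<rho> :: real
  assumes k_pos: "k > 0"
    and uniform: "uniform_hypergraph k E"
    and connected: "connected_hypergraph E"
    and \<rho>_nonneg: "\<rho> \<ge> 0"
    and pos: "x i > 0"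
    and eigen: "link_sum E x i = \<rho> * x i ^ (k - 1)"
begin

text \<open>The least admissible factor is the largest ratio \<open>y i / x i\<close>; it is
  attained at a vertex \<open>a\<close>, where \<open>y\<close> touches
  \<open>t * x\<close>.\<close>

lemma dominating_multiple:
  assumes "\<And>i. y i \<ge> 0" "\<exists>i. y i \<noteq> 0"
  obtains t a where "t > 0" "\<And>i. y i \<le> t * x i" "y a = t * x a"
proof -
  define t where "t = Max (range (\<lambda>i. y i / x i))"
  have le: "y i / x i \<le> t" for i unfolding t_def by (intro Max_ge) auto
  have "t \<in> range (\<lambda>i. y i / x i)" unfolding t_def by (intro Max_in) auto
  then obtain a where a: "t = y a / x a" by blast
  obtain b where b: "y b > 0" using assms by (metis less_eq_real_def)
  have "0 < y b / x b" using b pos by simp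
  hence "t > 0" using le[of b] by linarith
  moreover have "y i \<le> t * x i" for i using le[of i] pos[of i] by (simp add: field_simps)
  moreover have "y a = t * x a" using a pos[of a] by simp
  ultimately show ?thesis using that by blast
qed

text \<open>At the touching vertex \<open>a\<close>, monotonicity of \<open>link_sum\<close> gives
  \<open>\<mu> * y a ^ (k - 1) \<le> \<rho> * y a ^ (k - 1)\<close>, and
  \<open>y a > 0\<close>.\<close>

lemma subeigenvalue_le:
  assumes y: "\<And>i. y i \<ge> 0" "\<exists>i. y i \<noteq> 0" and sub: "\<And>i. \<mu> * y i ^ (k - 1) \<le> link_sum E y i"
  shows "\<mu> \<le> \<rho>"
proof -
  obtain t a where t: "t > 0" "\<And>i. y i \<le> t * x i" "y a = t * x a"
    using dominating_multiple[OF y] by blast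
  have "\<mu> * y a ^ (k - 1) \<le> link_sum E y a" by (rule sub)
  also have "\<dots> \<le> link_sum E (\<lambda>j. t * x j) a" by (rule link_sum_mono) (auto simp: y t)
  also have "\<dots> = \<rho> * y a ^ (k - 1)"
    by (simp add: link_sum_scale[OF uniform] eigen t power_mult_distrib)
  finally show ?thesis using t pos[of a] by simp
qed

text \<open>If \<open>y\<close> touches \<open>t * x\<close> at \<open>i\<close>, the link sums
  there agree, which forces touching at every vertex sharing an edge with \<open>i\<close>;
  connectedness does the rest.\<close>

lemma subeigenvector_is_multiple:
  assumes y: "\<And>i. y i \<ge> 0" "\<exists>i. y i \<noteq> 0" and sub: "\<And>i. \<rho> * y i ^ (k - 1) \<le> link_sum E y i"
  obtains t where "t > 0" "y = (\<lambda>i. t * x i)"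
proof -
  obtain t a where t: "t > 0" "\<And>i. y i \<le> t * x i" "y a = t * x a"
    using dominating_multiple[OF y] by blast
  have "y v = t * x v" for v
    using connected
  proof (rule connected_hypergraph_induct[where P = "\<lambda>v. y v = t * x v", OF _ t(3)])
    fix e i j assume e: "e \<in> E" "i \<in> e" "j \<in> e" and i: "y i = t * x i"
    have "link_sum E (\<lambda>j. t * x j) i = \<rho> * y i ^ (k - 1)"
      by (simp add: link_sum_scale[OF uniform] eigen i power_mult_distrib)
    also have "\<dots> \<le> link_sum E y i" by (rule sub)
    finally have "link_sum E y i = link_sum E (\<lambda>j. t * x j) i"
      using link_sum_mono[of y "\<lambda>j. t * x j" E i] y t by (intro antisym) auto
    \<comment> \<open>The terms of \<open>y\<close> are bounded by those of \<open>t * x\<close>, so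
      equal sums force equal terms.\<close>
    hence "(\<Prod>l\<in>e - {i}. y l) = (\<Prod>l\<in>e - {i}. t * x l)"
      unfolding link_sum_def
      by (rule sum_mono_inv[of _ "{e. e \<in> E \<and> i \<in> e}"]) (auto intro!: prod_mono simp: e y t)
    thus "y j = t * x j"
      using i e prod_eq_imp_eq[of "e - {i}" y "\<lambda>l. t * x l" j] y t pos by (cases "j = i") auto
  qed
  thus ?thesis using that t(1) by blast
qed

section \<open>The spectral radius and its negative as eigenvalues\<close>

lemma eigenvalue: "tensor_eigenvalue k (adjacency_tensor k E) (complex_of_real \<rho>)"
proof -
  have "link_sum E (\<lambda>j. complex_of_real (x j)) i = complex_of_real (link_sum E x i)" for i
    by (simp add: link_sum_def)
  thus ?thesis
    unfolding tensor_eigenvalue_adjacency_iff[OF k_pos uniform]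
    using pos by (intro exI[of _ "\<lambda>j. complex_of_real (x j)"]) (auto simp: eigen less_imp_neq[symmetric])
qed

text \<open>By the triangle inequality the moduli of any eigenvector satisfy the hypothesis of
  \<open>subeigenvalue_le\<close> with \<open>cmod \<mu>\<close>.\<close>

lemma spectral_radius: "tensor_spectral_radius k (adjacency_tensor k E) = \<rho>"
  unfolding tensor_spectral_radius_def
proof (rule Greatest_equality)
  show "\<exists>\<mu>. tensor_eigenvalue k (adjacency_tensor k E) \<mu> \<and> \<rho> = cmod \<mu>"
    using eigenvalue \<rho>_nonneg by (intro exI[of _ "complex_of_real \<rho>"]) auto
next
  fix r assume "\<exists>\<mu>. tensor_eigenvalue k (adjacency_tensor k E) \<mu> \<and> r = cmod \<mu>"
  then obtain \<mu> z where r: "r = cmod \<mu>" and z: "\<exists>i. z i \<noteq> 0" "\<And>i. link_sum E z i = \<mu> * z i ^ (k - 1)"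
    unfolding tensor_eigenvalue_adjacency_iff[OF k_pos uniform] by auto
  show "r \<le> \<rho>"
  proof (rule subeigenvalue_le[of "\<lambda>i. cmod (z i)"])
    show "r * cmod (z i) ^ (k - 1) \<le> link_sum E (\<lambda>j. cmod (z j)) i" for i
      using norm_link_sum_le[of E z i] by (simp add: z r norm_mult norm_power)
  qed (use z in auto)
qed

text \<open>The moduli of \<open>z\<close> form a multiple of \<open>x\<close>, so the triangle
  inequality for \<open>link_sum E z i\<close> is an equality and all its terms share one
  phase.\<close>

lemma sgn_prod_edge:
  fixes z :: "'n \<Rightarrow> complex"
  assumes nz: "\<exists>i. z i \<noteq> 0" and z: "\<And>i. link_sum E z i = - complex_of_real \<rho> * z i ^ (k - 1)"
    and e: "e \<in> E" "i \<in> e"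
  shows "z i \<noteq> 0" and "(\<Prod>j\<in>e. sgn (z j)) = - (sgn (z i) ^ k)"
proof -
  define y where "y = (\<lambda>i. cmod (z i))"
  have sub: "\<rho> * y i ^ (k - 1) \<le> link_sum E y i" for i
    using norm_link_sum_le[of E z i] \<rho>_nonneg by (simp add: z y_def norm_mult norm_power)
  obtain t where t: "t > 0" "y = (\<lambda>i. t * x i)"
    using subeigenvector_is_multiple[of y] nz sub by (auto simp: y_def)
  have y_eigen: "link_sum E y i = \<rho> * y i ^ (k - 1)" for i
    by (simp add: t link_sum_scale[OF uniform] eigen power_mult_distrib)
  have y_pos: "y i > 0" for i using t pos by simp
  have z_nz: "z j \<noteq> 0" for j using y_pos[of j] by (auto simp: y_def)
  show "z i \<noteq> 0" by (rule z_nz)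
  have norm_sgn1: "cmod (sgn (z j)) = 1" for j using z_nz by (simp add: norm_sgn)
  have polar: "z j = of_real (y j) * sgn (z j)" for j
    using z_nz[of j] by (simp add: y_def sgn_eq)
  \<comment> \<open>The phase of the right-hand side of the eigenvector equation at
    \<open>i\<close>; dividing by it makes the sum of the terms \<open>g e\<close> real and
    nonnegative.\<close>
  define u where "u = - (sgn (z i) ^ (k - 1))"
  have u: "cmod u = 1" by (simp add: u_def norm_power norm_sgn1)
  hence u0: "u \<noteq> 0" by auto
  define g where "g = (\<lambda>e. (\<Prod>j\<in>e - {i}. z j) / u)"
  have g_norm: "cmod (g e) = (\<Prod>j\<in>e - {i}. y j)" for e
    by (simp add: g_def norm_divide u y_def prod_norm)
  have "(\<Sum>e | e \<in> E \<and> i \<in> e. g e) = link_sum E z i / u"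
    by (simp add: g_def link_sum_def sum_divide_distrib)
  also have "\<dots> = of_real (\<rho> * y i ^ (k - 1))"
  proof -
    have "link_sum E z i = of_real (\<rho> * y i ^ (k - 1)) * u"
      unfolding z by (subst polar) (simp add: u_def power_mult_distrib)
    thus ?thesis using u0 by simp
  qed
  finally have "(\<Sum>e | e \<in> E \<and> i \<in> e. Re (g e)) = (\<Sum>e | e \<in> E \<and> i \<in> e. cmod (g e))"
    using y_eigen[of i] unfolding g_norm link_sum_def Re_sum[symmetric] by simp
  \<comment> \<open>Real parts never exceed moduli, so equality of the sums holds termwise.\<close>
  hence "Re (g e) = cmod (g e)"
    by (rule sum_mono_inv[of _ "{e. e \<in> E \<and> i \<in> e}"]) (auto simp: e complex_Re_le_cmod)
  hence ge: "g e = of_real (cmod (g e))"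
    using cmod_power2[of "g e"] by (simp add: complex_eq_iff)
  have "(\<Prod>j\<in>e - {i}. z j) = of_real (\<Prod>j\<in>e - {i}. y j) * (\<Prod>j\<in>e - {i}. sgn (z j))"
    unfolding of_real_prod prod.distrib[symmetric] by (intro prod.cong refl polar)
  moreover have "(\<Prod>j\<in>e - {i}. z j) = of_real (\<Prod>j\<in>e - {i}. y j) * u"
    using ge u0 unfolding g_norm by (simp add: g_def field_simps)
  moreover have "(\<Prod>j\<in>e - {i}. y j) > 0" by (intro prod_pos) (simp add: y_pos)
  ultimately have "(\<Prod>j\<in>e - {i}. sgn (z j)) = u" by (metis mult_left_cancel of_real_eq_0_iff less_irrefl)
  hence "(\<Prod>j\<in>e. sgn (z j)) = sgn (z i) * u" using e by (simp add: prod.remove[of e i])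
  also have "\<dots> = - (sgn (z i) ^ k)" using k_pos by (simp add: u_def power_eq_if)
  finally show "(\<Prod>j\<in>e. sgn (z j)) = - (sgn (z i) ^ k)" .
qed

lemma neg_eigenvalue_if_odd_bipartite:
  assumes "even k" "odd_bipartite E"
  shows "tensor_eigenvalue k (adjacency_tensor k E) (- complex_of_real \<rho>)"
proof -
  obtain V where V: "\<And>e. e \<in> E \<Longrightarrow> odd (card (e \<inter> V))"
    using assms(2) by (auto simp: odd_bipartite_def)
  define s :: "'n \<Rightarrow> complex" where "s = (\<lambda>j. if j \<in> V then -1 else 1)"
  \<comment> \<open>For even \<open>k\<close> the exponent \<open>k - 1\<close> is odd, so it
    preserves signs.\<close>
  have s_pow: "s j ^ (k - 1) = s j" for j using assms(1) k_pos by (simp add: s_def)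
  obtain z where z: "\<exists>i. z i \<noteq> 0" "\<And>i. link_sum E z i = complex_of_real \<rho> * z i ^ (k - 1)"
    using eigenvalue unfolding tensor_eigenvalue_adjacency_iff[OF k_pos uniform] by auto
  have flip: "(\<Prod>j\<in>e - {i}. s j) = - s i" if "e \<in> E" "i \<in> e" for e i
  proof -
    have "(\<Prod>j\<in>e. s j) = (-1) ^ card (e \<inter> V)" by (simp add: s_def prod.If_cases)
    also have "\<dots> = -1" using V that by simp
    \<comment> \<open>The signs over a whole edge multiply to -1, and \<open>s i\<close> is its own
      inverse.\<close>
    finally have "s i * (\<Prod>j\<in>e - {i}. s j) = -1" using that by (simp add: prod.remove[of e i])
    thus ?thesis by (auto simp: s_def split: if_splits)
  qed
  have "link_sum E (\<lambda>j. s j * z j) i = - s i * link_sum E z i" for i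
    unfolding link_sum_def sum_distrib_left
    by (intro sum.cong refl) (simp add: prod.distrib flip)
  hence "link_sum E (\<lambda>j. s j * z j) i = - complex_of_real \<rho> * (s i * z i) ^ (k - 1)" for i
    unfolding z power_mult_distrib s_pow by (simp del: power_Suc)
  moreover have "\<exists>i. s i * z i \<noteq> 0" using z by (auto simp: s_def)
  ultimately show ?thesis
    unfolding tensor_eigenvalue_adjacency_iff[OF k_pos uniform]
    by (intro exI[of _ "\<lambda>j. s j * z j"] conjI allI)
qed

lemma odd_bipartite_if_neg_eigenvalue:
  assumes "\<not> 4 dvd k" and "tensor_eigenvalue k (adjacency_tensor k E) (- complex_of_real \<rho>)"
  shows "even k \<and> odd_bipartite E"
proof -
  obtain z where z: "\<exists>i. z i \<noteq> 0" "\<And>i. link_sum E z i = - complex_of_real \<rho> * z i ^ (k - 1)"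
    using assms(2) unfolding tensor_eigenvalue_adjacency_iff[OF k_pos uniform] by blast
  define \<theta> where "\<theta> = (\<lambda>j. sgn (z j))"
  note edge = sgn_prod_edge[OF z, folded fun_cong[OF \<theta>_def]]
  fix a :: 'n
  define c where "c = \<theta> a ^ k"
  obtain e0 where e0: "e0 \<in> E" "a \<in> e0" using connected_hypergraph_covers[OF connected] by blast
  have "\<theta> a \<noteq> 0" using edge(1)[OF e0] by (simp add: \<theta>_def sgn_zero_iff)
  hence c0: "c \<noteq> 0" by (simp add: c_def)
  have const: "\<theta> v ^ k = c" for v
  proof (rule connected_hypergraph_induct[OF connected, where P = "\<lambda>v. \<theta> v ^ k = c" and u = a])
    show "\<theta> j ^ k = c" if "e \<in> E" "i \<in> e" "j \<in> e" "\<theta> i ^ k = c" for e i j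
      \<comment> \<open>Both \<open>- (\<theta> i ^ k)\<close> and \<open>- (\<theta> j ^ k)\<close>
        equal the product over the common edge.\<close>
      using edge(2)[OF that(1,2)] edge(2)[OF that(1,3)] that(4) by simp
  qed (simp add: c_def)
  have prod_e: "(\<Prod>j\<in>e. \<theta> j) = - c" if "e \<in> E" for e
  proof -
    have "card e = k" using that uniform by (simp add: uniform_hypergraph_def)
    then obtain i where "i \<in> e" using k_pos by fastforce
    thus ?thesis using edge(2)[OF that] const by simp
  qed
  have card_e: "card e = k" if "e \<in> E" for e using that uniform by (simp add: uniform_hypergraph_def)
  have even: "even k"
  proof (rule ccontr)
    assume "odd k"
    \<comment> \<open>For odd \<open>k\<close> the two evaluations of this product would give
      \<open>- (c ^ k) = c ^ k\<close> with \<open>c\<close> nonzero.\<close>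
    have "(- c) ^ k = (\<Prod>j\<in>e0. \<theta> j ^ k)" using prod_e e0 by (simp add: prod_power_distrib[symmetric])
    also have "\<dots> = c ^ k" using const card_e e0 by simp
    finally show False using \<open>odd k\<close> c0 by (simp add: equal_neg_zero neg_equal_zero)
  qed
  define m where "m = k div 2"
  have m: "k = 2 * m" "odd m" using even assms(1) by (auto simp: m_def)
  \<comment> \<open>Dividing by \<open>\<theta> a\<close> turns the common \<open>k\<close>-th power
    \<open>c\<close> into 1, so the \<open>m\<close>-th powers are square roots of 1.\<close>
  define \<eta> where "\<eta> = (\<lambda>j. (\<theta> j / \<theta> a) ^ m)"
  have "\<eta> j ^ 2 = 1" for j
    using const[of j] c0 unfolding \<eta>_def c_def power_mult[symmetric] m(1)
    by (simp add: power_divide mult.commute)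
  hence \<eta>: "\<eta> j = 1 \<or> \<eta> j = -1" for j by (simp add: power2_eq_1_iff)
  define V where "V = {j. \<eta> j = -1}"
  have "odd (card (e \<inter> V))" if e: "e \<in> E" for e
  proof -
    have "(-1) ^ card (e \<inter> V) = (\<Prod>j\<in>e. if j \<in> V then -1 else 1 :: complex)"
      by (simp add: prod.If_cases)
    also have "\<dots> = (\<Prod>j\<in>e. \<eta> j)" using \<eta> by (intro prod.cong) (auto simp: V_def)
    \<comment> \<open>The denominator collects \<open>\<theta> a ^ m\<close> once for each of the
      \<open>k\<close> vertices of \<open>e\<close>.\<close>
    also have "\<dots> = (\<Prod>j\<in>e. \<theta> j) ^ m / (\<theta> a ^ k) ^ m"
      by (simp add: \<eta>_def prod_power_distrib[symmetric] prod_dividef power_divide card_e e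
        power_mult[symmetric] mult.commute)
    also have "\<dots> = (- c) ^ m / c ^ m" by (simp only: prod_e[OF e] c_def)
    also have "\<dots> = -1" using m(2) c0 by simp
    finally show ?thesis by (metis one_neq_neg_one neg_one_even_power)
  qed
  \<comment> \<open>Otherwise \<open>e0 \<inter> V\<close> would be all of \<open>e0\<close>, which
    has an even number \<open>k\<close> of vertices.\<close>
  moreover have "V \<noteq> UNIV" using calculation[OF e0(1)] card_e[OF e0(1)] even by auto
  ultimately show ?thesis using even unfolding odd_bipartite_def by blast
qed

end

theorem theorem3p5:
  fixes k :: nat and E :: "'n::finite set set"
  assumes "k \<ge> 2" and "\<not> 4 dvd k"
    and "uniform_hypergraph k E" and "connected_hypergraph E"
  shows "(even k \<and> odd_bipartite E) \<longleftrightarrow>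
    tensor_eigenvalue k (adjacency_tensor k E)
      (- complex_of_real (tensor_spectral_radius k (adjacency_tensor k E)))"
proof -
  have k: "k > 0" using assms(1) by simp
  obtain x :: "'n \<Rightarrow> real" and \<rho> where "\<rho> \<ge> 0" "\<And>i. x i > 0" "\<And>i. link_sum E x i = \<rho> * x i ^ (k - 1)"
    by (rule perron_vector_exists[OF k assms(3,4)]) (rule that)
  then interpret perron_vector k E x \<rho> using k assms by unfold_locales
  show ?thesis
    unfolding spectral_radius
    using neg_eigenvalue_if_odd_bipartite odd_bipartite_if_neg_eigenvalue[OF assms(2)] by blast
qed

end
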